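(* Let $X$ be a Bernoulli random variable with $\Pr\{X=1\}=1-\Pr\{X=0\}=p\in(0,1)$, let $X_1,X_2,\dots$ be i.i.d. samples of $X$, let $\gamma$ and $n$ be positive integers, and let $\mathbf{n}$ and $\mathbf{k}$ be the number of samples and the sample sum at termination of truncated inverse sampling with threshold $\gamma$ and maximum sample size $n$. Let $0<\delta<1$. Define the lower confidence limit $\underline{p}\in[0,1)$ such that $\underline{p}=0$ for $\mathbf{k}=0$ and $$\sum_{i=\mathbf{k}}^{\mathbf{n}}\binom{\mathbf{n}}{i}\underline{p}^{\,i}(1-\underline{p})^{\mathbf{n}-i}=\frac{\delta}{2}\quad\text{for }\mathbf{k}>0.$$ Define the upper confidence limit $\overline{p}\in(0,1]$ such that $\overline{p}=1$ for $\mathbf{k}=\mathbf{n}$ and $$\sum_{i=0}^{\mathbf{k}}\binom{\mathbf{n}}{i}\overline{p}^{\,i}(1-\overline{p})^{\mathbf{n}-i}=\frac{\delta}{2}\quad\text{for }\mathbf{k}<\mathbf{n}.$$ Then $\Pr\{\underline{p}<p<\overline{p}\}\ge1-\delta$.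
   Context: Truncated inverse sampling with threshold $\gamma$ and maximum sample size $n$: sampling continues until the sample sum is no less than $\gamma$ or the number of samples reaches $n$. Thus $\mathbf{n}=\min\{n,\ \min\{\ell\in\mathbb{N}:\sum_{i=1}^{\ell}X_i\ge\gamma\}\}$ (minimum of the empty set is $+\infty$) and $\mathbf{k}=\sum_{i=1}^{\mathbf{n}}X_i$. The limits $\underline{p},\overline{p}$ are random variables, being functions of $(\mathbf{n},\mathbf{k})$. *)

theory Defs
  imports "HOL-Probability.Probability" "HOL-Library.Extended_Nat"
begin

(* Samples are x 1, x 2, ...; the value x 0 is never used. The minimum is taken in
   enat, where Inf {} = \<infinity>, so that the result is n if the threshold is never reached. *)
definition stop_size :: "nat \<Rightarrow> nat \<Rightarrow> (nat \<Rightarrow> nat) \<Rightarrow> nat" where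
  "stop_size \<gamma> n x =
     the_enat (min (enat n) (Inf (enat ` {l. (\<Sum>i=1..l. x i) \<ge> \<gamma>})))"

definition stop_sum :: "nat \<Rightarrow> nat \<Rightarrow> (nat \<Rightarrow> nat) \<Rightarrow> nat" where
  "stop_sum \<gamma> n x = (\<Sum>i=1..stop_size \<gamma> n x. x i)"

definition is_lower_limit :: "real \<Rightarrow> nat \<Rightarrow> nat \<Rightarrow> real \<Rightarrow> bool" where
  "is_lower_limit \<delta> m k q \<longleftrightarrow>
     0 \<le> q \<and> q < 1 \<and>
     (k = 0 \<longrightarrow> q = 0) \<and>
     (k > 0 \<longrightarrow> (\<Sum>i=k..m. real (m choose i) * q ^ i * (1 - q) ^ (m - i)) = \<delta> / 2)"

definition is_upper_limit :: "real \<Rightarrow> nat \<Rightarrow> nat \<Rightarrow> real \<Rightarrow> bool" where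
  "is_upper_limit \<delta> m k q \<longleftrightarrow>
     0 < q \<and> q \<le> 1 \<and>
     (k = m \<longrightarrow> q = 1) \<and>
     (k < m \<longrightarrow> (\<Sum>i=0..k. real (m choose i) * q ^ i * (1 - q) ^ (m - i)) = \<delta> / 2)"

end

theory Submission
  imports Defs
begin

text \<open>Every outcome \<open>(m, k)\<close> has \<open>m = n\<close> or \<open>k = \<gamma>\<close>, so ordering the outcomes by increasing \<open>k\<close> and
  decreasing \<open>m\<close> makes them a chain. Let \<open>(m, k)\<close> be the least outcome whose lower limit is at
  least \<open>p\<close>. On any outcome that violates the lower limit at most \<open>m\<close> samples were taken and their sum is
  at least \<open>k\<close>, so the sum of the first \<open>m\<close> samples is at least \<open>k\<close> too; that binomial tail
  at \<open>p\<close> is at most the tail at the lower limit, which is \<open>\<delta> / 2\<close>. The upper limit is symmetric, with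
  the greatest violating outcome, and the union bound combines the two.\<close>

section \<open>The binomial distribution function\<close>

text \<open>The probability that a binomial variable with \<open>m\<close> trials and success
  probability \<open>q\<close> is strictly below \<open>k\<close>. The strict bound lets both limits
  use one function: the tail from \<open>k\<close> upwards is the complement at \<open>k\<close>,
  the tail up to \<open>k\<close> is the value at \<open>Suc k\<close>.\<close>

definition binomial_cdf :: "nat \<Rightarrow> nat \<Rightarrow> real \<Rightarrow> real" where
  "binomial_cdf m k q = (\<Sum>i<k. real (m choose i) * q ^ i * (1 - q) ^ (m - i))"

lemma binomial_cdf_0_right [simp]: "binomial_cdf m 0 q = 0"
  by (simp add: binomial_cdf_def)

lemma binomial_cdf_0_left: "binomial_cdf 0 k q = (if k = 0 then 0 else 1)"
proof (cases k)
  case (Suc j)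
  then show ?thesis
    by (simp add: binomial_cdf_def sum.lessThan_Suc_shift del: sum.lessThan_Suc)
qed simp

lemma binomial_term_Suc_0:
  "real (Suc m choose 0) * q ^ 0 * (1 - q) ^ (Suc m - 0) =
    (1 - q) * (real (m choose 0) * q ^ 0 * (1 - q) ^ (m - 0))"
  by simp

lemma binomial_term_Suc_Suc:
  "real (Suc m choose Suc i) * q ^ Suc i * (1 - q) ^ (Suc m - Suc i) =
    q * (real (m choose i) * q ^ i * (1 - q) ^ (m - i)) +
    (1 - q) * (real (m choose Suc i) * q ^ Suc i * (1 - q) ^ (m - Suc i))"
proof (cases "i < m")
  case True
  then have "m - i = Suc (m - Suc i)" by simp
  then show ?thesis by (simp add: algebra_simps)
next
  \<comment> \<open>Here \<open>m choose Suc i\<close> vanishes, so the truncated exponent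
    \<open>m - Suc i\<close> does no harm.\<close>
  case False
  then show ?thesis by (simp add: binomial_eq_0)
qed

text \<open>Conditioning on one trial: a success leaves room for one success fewer among the other
  \<open>m\<close>. This recursion drives both the monotonicity in \<open>q\<close> and the
  computation of the law of the partial sums.\<close>

lemma binomial_cdf_Suc_Suc:
  "binomial_cdf (Suc m) (Suc k) q = q * binomial_cdf m k q + (1 - q) * binomial_cdf m (Suc k) q"
  unfolding binomial_cdf_def sum.lessThan_Suc_shift[of _ k] binomial_term_Suc_0 binomial_term_Suc_Suc
  by (simp only: sum.distrib sum_distrib_left distrib_left ac_simps)

lemma binomial_cdf_le_Suc:
  assumes "0 \<le> q" "q \<le> 1"
  shows "binomial_cdf m k q \<le> binomial_cdf m (Suc k) q"
  using assms by (simp add: binomial_cdf_def)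

text \<open>Induction on \<open>m\<close> along the recursion, without derivatives: the two inner
  values decrease by the induction hypothesis, and raising the weight from \<open>q\<close> to
  \<open>r\<close> shifts mass to the smaller one, \<open>binomial_cdf m j q\<close>.\<close>

lemma binomial_cdf_antimono:
  assumes "0 \<le> q" "q \<le> r" "r \<le> 1"
  shows "binomial_cdf m k r \<le> binomial_cdf m k q"
proof (induction m arbitrary: k)
  case 0
  show ?case by (simp add: binomial_cdf_0_left)
next
  case (Suc m)
  show ?case
  proof (cases k)
    case (Suc j)
    let ?F = "\<lambda>k q. binomial_cdf m k q"
    have "r * ?F j r + (1 - r) * ?F (Suc j) r \<le> r * ?F j q + (1 - r) * ?F (Suc j) q"
      using assms by (intro add_mono mult_left_mono Suc.IH) auto
    also have "\<dots> = q * ?F j q + (1 - q) * ?F (Suc j) q - (r - q) * (?F (Suc j) q - ?F j q)"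
      by (simp add: algebra_simps)
    also have "\<dots> \<le> q * ?F j q + (1 - q) * ?F (Suc j) q"
      using assms binomial_cdf_le_Suc[of q m j] by simp
    finally show ?thesis
      by (simp add: Suc binomial_cdf_Suc_Suc)
  qed simp
qed

lemma binomial_cdf_total: "binomial_cdf m (Suc m) q = 1"
  using binomial_ring[of q "1 - q" m]
  by (simp add: binomial_cdf_def lessThan_Suc_atMost)

lemma binomial_upper_sum:
  assumes "k \<le> m"
  shows "(\<Sum>i=k..m. real (m choose i) * q ^ i * (1 - q) ^ (m - i)) = 1 - binomial_cdf m k q"
proof -
  have "{..<Suc m} = {..<k} \<union> {k..m}" "{..<k} \<inter> {k..m} = {}"
    using assms by auto
  then have "binomial_cdf m (Suc m) q = binomial_cdf m k q +
      (\<Sum>i=k..m. real (m choose i) * q ^ i * (1 - q) ^ (m - i))"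
    unfolding binomial_cdf_def by (simp add: sum.union_disjoint)
  then show ?thesis by (simp add: binomial_cdf_total)
qed

lemma binomial_lower_sum:
  "(\<Sum>i=0..k. real (m choose i) * q ^ i * (1 - q) ^ (m - i)) = binomial_cdf m (Suc k) q"
  by (simp add: binomial_cdf_def lessThan_Suc_atMost atMost_atLeast0)

lemma lower_limit_ge_imp_tail_le:
  assumes "is_lower_limit \<delta> m k q" "0 < p" "p \<le> q" "k \<le> m"
  shows "1 - binomial_cdf m k p \<le> \<delta> / 2"
proof -
  \<comment> \<open>\<open>k = 0\<close> would force \<open>q = 0\<close>, against
    \<open>0 < p \<le> q\<close>.\<close>
  have "k > 0" and q: "0 \<le> q" "q < 1"
    using assms by (auto simp: is_lower_limit_def)
  then have "1 - binomial_cdf m k q = \<delta> / 2"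
    using assms by (simp add: is_lower_limit_def binomial_upper_sum)
  moreover have "binomial_cdf m k q \<le> binomial_cdf m k p"
    using assms q by (intro binomial_cdf_antimono) auto
  ultimately show ?thesis by simp
qed

lemma upper_limit_le_imp_cdf_le:
  assumes "is_upper_limit \<delta> m k q" "p < 1" "q \<le> p" "k \<le> m"
  shows "binomial_cdf m (Suc k) p \<le> \<delta> / 2"
proof -
  \<comment> \<open>\<open>k = m\<close> would force \<open>q = 1\<close>, against
    \<open>q \<le> p < 1\<close>.\<close>
  have "k < m" and q: "0 < q" "q \<le> 1"
    using assms by (auto simp: is_upper_limit_def)
  then have "binomial_cdf m (Suc k) q = \<delta> / 2"
    using assms by (simp add: is_upper_limit_def binomial_lower_sum)
  moreover have "binomial_cdf m (Suc k) p \<le> binomial_cdf m (Suc k) q"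
    using assms q by (intro binomial_cdf_antimono) auto
  ultimately show ?thesis by simp
qed

section \<open>Partial sums of Bernoulli variables\<close>

lemma measurable_sum_nat:
  fixes f :: "'i \<Rightarrow> 'a \<Rightarrow> nat"
  assumes "\<And>i. i \<in> A \<Longrightarrow> f i \<in> measurable N (count_space UNIV)"
  shows "(\<lambda>x. \<Sum>i\<in>A. f i x) \<in> measurable N (count_space UNIV)"
proof -
  \<comment> \<open>The Borel sigma-algebra on the naturals is the discrete one, so measurability of
    Borel sums carries over.\<close>
  have eq: "measurable N (count_space UNIV) = (borel_measurable N :: ('a \<Rightarrow> nat) set)"
    by (intro measurable_cong_sets) (simp_all add: sets_borel_eq_count_space)
  show ?thesis
    using assms unfolding eq by (intro borel_measurable_sum) auto
qed

context prob_space
begin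

text \<open>Disjoint blocks of an independent family are independent, and so are functions of them:
  here a projection of the block \<open>{j}\<close> and the sum over the block
  \<open>A\<close>.\<close>

lemma indep_var_sum_nat:
  fixes X :: "'i \<Rightarrow> 'a \<Rightarrow> nat"
  assumes ind: "indep_vars (\<lambda>_. count_space UNIV) X I" and "j \<in> I" "A \<subseteq> I" "j \<notin> A"
  shows "indep_var (count_space UNIV) (X j) (count_space UNIV) (\<lambda>\<omega>. \<Sum>i\<in>A. X i \<omega>)"
proof -
  have "indep_var (PiM {j} (\<lambda>_. count_space UNIV)) (\<lambda>\<omega>. restrict (\<lambda>i. X i \<omega>) {j})
      (PiM A (\<lambda>_. count_space UNIV)) (\<lambda>\<omega>. restrict (\<lambda>i. X i \<omega>) A)"
    using assms by (intro indep_var_restrict[OF ind]) auto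
  then have "indep_var (count_space UNIV) ((\<lambda>f. f j) \<circ> (\<lambda>\<omega>. restrict (\<lambda>i. X i \<omega>) {j}))
      (count_space UNIV) ((\<lambda>f. \<Sum>i\<in>A. f i) \<circ> (\<lambda>\<omega>. restrict (\<lambda>i. X i \<omega>) A))"
    by (rule indep_var_compose)
      (auto intro!: measurable_sum_nat measurable_component_singleton[where M="\<lambda>_. count_space UNIV"])
  moreover have "(\<lambda>f. f j) \<circ> (\<lambda>\<omega>. restrict (\<lambda>i. X i \<omega>) {j}) = X j"
    by auto
  moreover have "(\<lambda>f. \<Sum>i\<in>A. f i) \<circ> (\<lambda>\<omega>. restrict (\<lambda>i. X i \<omega>) A) = (\<lambda>\<omega>. \<Sum>i\<in>A. X i \<omega>)"
    by (auto simp: fun_eq_iff)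
  ultimately show ?thesis by simp
qed

text \<open>The values 0 and 1 already carry total mass \<open>p + (1 - p) = 1\<close>; other values
  may occur on a null set.\<close>

lemma AE_bernoulli_le_1:
  fixes Y :: "'a \<Rightarrow> nat"
  assumes [measurable]: "Y \<in> measurable M (count_space UNIV)"
    and "prob {\<omega> \<in> space M. Y \<omega> = 1} = p" "prob {\<omega> \<in> space M. Y \<omega> = 0} = 1 - p"
  shows "AE \<omega> in M. Y \<omega> \<le> 1"
proof -
  have "{\<omega> \<in> space M. Y \<omega> \<le> 1} = {\<omega> \<in> space M. Y \<omega> = 1} \<union> {\<omega> \<in> space M. Y \<omega> = 0}"
    by auto
  also have "prob \<dots> = prob {\<omega> \<in> space M. Y \<omega> = 1} + prob {\<omega> \<in> space M. Y \<omega> = 0}"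
    by (intro finite_measure_Union) auto
  finally have "prob {\<omega> \<in> space M. Y \<omega> \<le> 1} = 1"
    using assms by simp
  then show ?thesis
    by (simp add: prob_Collect_eq_1)
qed

text \<open>Splitting on the last sample, which is independent of the earlier sum, reproduces the
  recursion of \<open>binomial_cdf\<close>.\<close>

lemma prob_bernoulli_sum_less:
  fixes X :: "nat \<Rightarrow> 'a \<Rightarrow> nat"
  assumes ind: "indep_vars (\<lambda>_. count_space UNIV) X {1..}"
    and one: "\<And>i. i \<ge> 1 \<Longrightarrow> prob {\<omega> \<in> space M. X i \<omega> = 1} = p"
    and zero: "\<And>i. i \<ge> 1 \<Longrightarrow> prob {\<omega> \<in> space M. X i \<omega> = 0} = 1 - p"
  shows "prob {\<omega> \<in> space M. (\<Sum>i=1..m. X i \<omega>) < k} = binomial_cdf m k p"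
proof (induction m arbitrary: k)
  case 0
  show ?case by (simp add: binomial_cdf_0_left prob_space)
next
  case (Suc m)
  show ?case
  proof (cases k)
    case 0
    then show ?thesis by simp
  next
    case (Suc j)
    let ?S = "\<lambda>\<omega>. \<Sum>i=1..m. X i \<omega>"
    let ?Y = "X (Suc m)"
    have iv: "indep_var (count_space UNIV) ?Y (count_space UNIV) ?S"
      by (rule indep_var_sum_nat[OF ind]) auto
    have [measurable]: "?Y \<in> measurable M (count_space UNIV)" "?S \<in> measurable M (count_space UNIV)"
      using indep_var_rv1[OF iv] indep_var_rv2[OF iv] by auto
    have [measurable]: "(\<lambda>\<omega>. \<Sum>i=1..Suc m. X i \<omega>) \<in> measurable M (count_space UNIV)"
    proof (rule measurable_sum_nat)
      fix i :: nat assume "i \<in> {1..Suc m}"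
      then show "X i \<in> measurable M (count_space UNIV)"
        using ind by (auto simp: indep_vars_def)
    qed
    have le1: "AE \<omega> in M. ?Y \<omega> \<le> 1"
      by (rule AE_bernoulli_le_1[OF _ one zero]) auto
    have ev: "{\<omega> \<in> space M. ?Y \<omega> = a \<and> ?S \<omega> < b} \<in> events" for a b
      by measurable
    have prod: "prob {\<omega> \<in> space M. ?Y \<omega> = a \<and> ?S \<omega> < b} =
        prob {\<omega> \<in> space M. ?Y \<omega> = a} * binomial_cdf m b p" for a b
    proof -
      have "(\<lambda>x. (?Y x, ?S x)) -` ({a} \<times> {..<b}) \<inter> space M = {\<omega> \<in> space M. ?Y \<omega> = a \<and> ?S \<omega> < b}"
        "?Y -` {a} \<inter> space M = {\<omega> \<in> space M. ?Y \<omega> = a}"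
        "?S -` {..<b} \<inter> space M = {\<omega> \<in> space M. ?S \<omega> < b}"
        by auto
      then show ?thesis
        using indep_varD[OF iv, of "{a}" "{..<b}"] Suc.IH[of b] by simp
    qed
    have "prob {\<omega> \<in> space M. (\<Sum>i=1..Suc m. X i \<omega>) < k} =
        prob ({\<omega> \<in> space M. ?Y \<omega> = 1 \<and> ?S \<omega> < j} \<union> {\<omega> \<in> space M. ?Y \<omega> = 0 \<and> ?S \<omega> < Suc j})"
    \<comment> \<open>The two events agree only almost everywhere, since the last sample may exceed
      1 on a null set.\<close>
    proof (rule finite_measure_eq_AE)
      show "AE \<omega> in M. \<omega> \<in> {\<omega> \<in> space M. (\<Sum>i=1..Suc m. X i \<omega>) < k} \<longleftrightarrow>
          \<omega> \<in> {\<omega> \<in> space M. ?Y \<omega> = 1 \<and> ?S \<omega> < j} \<union> {\<omega> \<in> space M. ?Y \<omega> = 0 \<and> ?S \<omega> < Suc j}"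
        using le1 by eventually_elim (auto simp: Suc le_Suc_eq)
      show "{\<omega> \<in> space M. (\<Sum>i=1..Suc m. X i \<omega>) < k} \<in> events"
        by measurable
      show "{\<omega> \<in> space M. ?Y \<omega> = 1 \<and> ?S \<omega> < j} \<union> {\<omega> \<in> space M. ?Y \<omega> = 0 \<and> ?S \<omega> < Suc j} \<in> events"
        by (intro sets.Un ev)
    qed
    also have "\<dots> = prob {\<omega> \<in> space M. ?Y \<omega> = 1 \<and> ?S \<omega> < j} +
        prob {\<omega> \<in> space M. ?Y \<omega> = 0 \<and> ?S \<omega> < Suc j}"
      by (rule finite_measure_Union[OF ev ev]) auto
    also have "\<dots> = p * binomial_cdf m j p + (1 - p) * binomial_cdf m (Suc j) p"
      unfolding prod using one[of "Suc m"] zero[of "Suc m"] by simp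
    finally show ?thesis
      by (simp add: Suc binomial_cdf_Suc_Suc)
  qed
qed

end

section \<open>Outcomes of truncated inverse sampling\<close>

lemma stop_size_le: "stop_size \<gamma> n x \<le> n"
  and sum_before_stop_size: "l < stop_size \<gamma> n x \<Longrightarrow> (\<Sum>i=1..l. x i) < \<gamma>"
  and sum_at_stop_size: "stop_size \<gamma> n x < n \<Longrightarrow> \<gamma> \<le> (\<Sum>i=1..stop_size \<gamma> n x. x i)"
proof -
  define A where "A = {l. (\<Sum>i=1..l. x i) \<ge> \<gamma>}"
  have "min (enat n) (Inf (enat ` A)) \<noteq> \<infinity>"
    by (cases "Inf (enat ` A)") auto
  then have N: "enat (stop_size \<gamma> n x) = min (enat n) (Inf (enat ` A))"
    by (auto simp: stop_size_def A_def)
  then show "stop_size \<gamma> n x \<le> n"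
    by (metis enat_ord_simps(1) min.cobounded1)
  show "(\<Sum>i=1..l. x i) < \<gamma>" if "l < stop_size \<gamma> n x"
  proof (rule ccontr)
    assume "\<not> (\<Sum>i=1..l. x i) < \<gamma>"
    then have "Inf (enat ` A) \<le> enat l"
      by (intro Inf_lower) (auto simp: A_def)
    then have "enat (stop_size \<gamma> n x) \<le> enat l"
      unfolding N by (rule min.coboundedI2)
    with that show False by simp
  qed
  show "\<gamma> \<le> (\<Sum>i=1..stop_size \<gamma> n x. x i)" if "stop_size \<gamma> n x < n"
  proof -
    have Inf: "Inf (enat ` A) = enat (stop_size \<gamma> n x)"
      using N that by (metis enat_ord_simps(2) min_def nless_le)
    \<comment> \<open>The infimum is finite, so the set is nonempty and its least element attains
      it.\<close>
    then have "A \<noteq> {}"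
      by (auto simp: Inf_enat_def)
    then have "Inf (enat ` A) \<in> enat ` A"
      unfolding Inf_enat_def by (auto intro: LeastI)
    then show ?thesis
      unfolding Inf by (auto simp: A_def)
  qed
qed

text \<open>Expresses stopping at \<open>m\<close> through partial sums alone, which later yields
  measurability. Uniqueness: of two candidates, the smaller would have a sum both below
  \<open>\<gamma>\<close> and at least \<open>\<gamma>\<close>.\<close>

lemma stop_size_eq_iff:
  "stop_size \<gamma> n x = m \<longleftrightarrow>
    m \<le> n \<and> (\<forall>l<m. (\<Sum>i=1..l. x i) < \<gamma>) \<and> (m < n \<longrightarrow> \<gamma> \<le> (\<Sum>i=1..m. x i))"
  (is "_ \<longleftrightarrow> ?R m")
proof
  assume "stop_size \<gamma> n x = m"
  then show "?R m"
    using stop_size_le sum_before_stop_size sum_at_stop_size by blast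
next
  assume "?R m"
  moreover have "?R (stop_size \<gamma> n x)"
    using stop_size_le sum_before_stop_size sum_at_stop_size by blast
  ultimately show "stop_size \<gamma> n x = m"
    by (metis le_neq_implies_less leD linorder_neqE_nat order_less_le_trans)
qed

text \<open>An L-shaped path: \<open>k\<close> climbs towards \<open>\<gamma>\<close> along
  \<open>m = n\<close>, then \<open>m\<close> descends along \<open>k = \<gamma>\<close>.\<close>

definition outcomes :: "nat \<Rightarrow> nat \<Rightarrow> (nat \<times> nat) set" where
  "outcomes \<gamma> n = {(m, k). 1 \<le> m \<and> m \<le> n \<and> k \<le> m \<and> k \<le> \<gamma> \<and> (m = n \<or> k = \<gamma>)}"

text \<open>Samples of at most 1 cannot overshoot: the sum is below \<open>\<gamma>\<close> before
  the last sample, so stopping before \<open>n\<close> happens with sum exactly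
  \<open>\<gamma>\<close>.\<close>

lemma stop_in_outcomes:
  assumes "\<gamma> > 0" "n > 0" and x: "\<And>i. i \<ge> 1 \<Longrightarrow> x i \<le> 1"
  shows "(stop_size \<gamma> n x, stop_sum \<gamma> n x) \<in> outcomes \<gamma> n"
proof -
  define m where "m = stop_size \<gamma> n x"
  have m: "m \<le> n" "\<And>l. l < m \<Longrightarrow> (\<Sum>i=1..l. x i) < \<gamma>" "m < n \<Longrightarrow> \<gamma> \<le> (\<Sum>i=1..m. x i)"
    using stop_size_eq_iff[of \<gamma> n x m] by (auto simp: m_def)
  \<comment> \<open>The empty sum is 0, hence below \<open>\<gamma>\<close>, so sampling cannot stop
    before the first sample.\<close>
  have "m \<noteq> 0"
    using assms m(3) by (metis atLeastatMost_empty sum.empty leD zero_less_one)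
  then obtain l where l: "m = Suc l"
    using not0_implies_Suc by blast
  have "(\<Sum>i=1..m. x i) \<le> (\<Sum>i=1..m. 1)"
    using x by (intro sum_mono) auto
  moreover have "(\<Sum>i=1..m. x i) \<le> \<gamma>"
    using m(2)[of l] x[of m] by (simp add: l)
  ultimately show ?thesis
    using m(1,3) \<open>m \<noteq> 0\<close> by (cases "m = n") (auto simp: outcomes_def stop_sum_def simp flip: m_def)
qed

text \<open>The hypothesis compares \<open>k - m\<close> with \<open>k' - m'\<close> without
  subtraction. This difference increases strictly along the path, so it decides both coordinates at
  once.\<close>

lemma outcomes_chain:
  assumes "(m, k) \<in> outcomes \<gamma> n" "(m', k') \<in> outcomes \<gamma> n" "k + m' \<le> k' + m"
  shows "m' \<le> m \<and> k \<le> k'"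
  using assms by (auto simp: outcomes_def)

lemma outcomes_least:
  assumes "R \<subseteq> outcomes \<gamma> n" "R \<noteq> {}"
  obtains m k where "(m, k) \<in> R" "\<And>m' k'. (m', k') \<in> R \<Longrightarrow> m' \<le> m \<and> k \<le> k'"
proof -
  \<comment> \<open>The measure is \<open>k - m\<close> shifted by \<open>n\<close>; truncation is
    harmless since \<open>m \<le> n\<close> on outcomes.\<close>
  obtain z where z: "z \<in> R" "\<And>y. y \<in> R \<Longrightarrow> snd z + (n - fst z) \<le> snd y + (n - fst y)"
    using ex_has_least_nat[of "\<lambda>z. z \<in> R" _ "\<lambda>z. snd z + (n - fst z)"] assms(2) by blast
  show thesis
  proof (rule that[of "fst z" "snd z"])
    fix m' k' assume y: "(m', k') \<in> R"
    have "m' \<le> n" "fst z \<le> n"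
      using assms(1) y z(1) by (auto simp: outcomes_def)
    then have "snd z + m' \<le> k' + fst z"
      using z(2)[OF y] by simp
    then show "m' \<le> fst z \<and> snd z \<le> k'"
      using assms(1) y z(1) by (intro outcomes_chain[of _ _ \<gamma> n]) auto
  qed (use z in auto)
qed

lemma outcomes_greatest:
  assumes "R \<subseteq> outcomes \<gamma> n" "R \<noteq> {}"
  obtains m k where "(m, k) \<in> R" "\<And>m' k'. (m', k') \<in> R \<Longrightarrow> m \<le> m' \<and> k' \<le> k"
proof -
  \<comment> \<open>Minimizing \<open>m - k\<close>, shifted by \<open>\<gamma>\<close>, finds the
    far end of the chain; \<open>k \<le> \<gamma>\<close> keeps the subtraction exact.\<close>
  obtain z where z: "z \<in> R" "\<And>y. y \<in> R \<Longrightarrow> fst z + (\<gamma> - snd z) \<le> fst y + (\<gamma> - snd y)"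
    using ex_has_least_nat[of "\<lambda>z. z \<in> R" _ "\<lambda>z. fst z + (\<gamma> - snd z)"] assms(2) by blast
  show thesis
  proof (rule that[of "fst z" "snd z"])
    fix m' k' assume y: "(m', k') \<in> R"
    have "k' \<le> \<gamma>" "snd z \<le> \<gamma>"
      using assms(1) y z(1) by (auto simp: outcomes_def)
    then have "k' + fst z \<le> snd z + m'"
      using z(2)[OF y] by simp
    then show "fst z \<le> m' \<and> k' \<le> snd z"
      using assms(1) y z(1) by (intro outcomes_chain[of _ _ \<gamma> n]) auto
  qed (use z in auto)
qed

lemma sum_initial_mono:
  fixes x :: "nat \<Rightarrow> nat"
  assumes "m \<le> m'"
  shows "(\<Sum>i=1..m. x i) \<le> (\<Sum>i=1..m'. x i)"
  using assms by (intro sum_mono2) auto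

section \<open>Coverage probability\<close>

theorem theorem6:
  fixes M :: "'a measure"
    and X :: "nat \<Rightarrow> 'a \<Rightarrow> nat"
    and p \<delta> :: real
    and \<gamma> n :: nat
    and L U :: "nat \<Rightarrow> nat \<Rightarrow> real"
  assumes "prob_space M"
    and "0 < p" and "p < 1"
    and "prob_space.indep_vars M (\<lambda>_. count_space UNIV) X {1..}"
    and "\<And>i. i \<ge> 1 \<Longrightarrow> measure M {\<omega> \<in> space M. X i \<omega> = 1} = p"
    and "\<And>i. i \<ge> 1 \<Longrightarrow> measure M {\<omega> \<in> space M. X i \<omega> = 0} = 1 - p"
    and "\<gamma> > 0" and "n > 0"
    and "0 < \<delta>" and "\<delta> < 1"
    and "\<And>m k. 1 \<le> m \<Longrightarrow> m \<le> n \<Longrightarrow> k \<le> m \<Longrightarrow> is_lower_limit \<delta> m k (L m k)"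
    and "\<And>m k. 1 \<le> m \<Longrightarrow> m \<le> n \<Longrightarrow> k \<le> m \<Longrightarrow> is_upper_limit \<delta> m k (U m k)"
  shows "measure M {\<omega> \<in> space M.
           L (stop_size \<gamma> n (\<lambda>i. X i \<omega>)) (stop_sum \<gamma> n (\<lambda>i. X i \<omega>)) < p \<and>
           p < U (stop_size \<gamma> n (\<lambda>i. X i \<omega>)) (stop_sum \<gamma> n (\<lambda>i. X i \<omega>))} \<ge> 1 - \<delta>"
proof -
  interpret prob_space M by fact
  note ind = assms(4) and bern = assms(5,6)
  let ?S = "\<lambda>m \<omega>. \<Sum>i=1..m. X i \<omega>"
  let ?N = "\<lambda>\<omega>. stop_size \<gamma> n (\<lambda>i. X i \<omega>)"
  let ?K = "\<lambda>\<omega>. stop_sum \<gamma> n (\<lambda>i. X i \<omega>)"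
  have rv: "X i \<in> measurable M (count_space UNIV)" if "i \<ge> 1" for i
    using ind that by (auto simp: indep_vars_def)
  have S [measurable]: "?S m \<in> measurable M (count_space UNIV)" for m
    by (intro measurable_sum_nat rv) auto
  have cdf: "prob {\<omega> \<in> space M. ?S m \<omega> < k} = binomial_cdf m k p" for m k
    by (rule prob_bernoulli_sum_less[OF ind bern])
  have tail: "prob {\<omega> \<in> space M. k \<le> ?S m \<omega>} = 1 - binomial_cdf m k p" for m k
  proof -
    have "{\<omega> \<in> space M. ?S m \<omega> < k} \<in> events"
      by measurable
    from prob_neg[OF this] show ?thesis
      unfolding cdf not_less .
  qed
  have "AE \<omega> in M. \<forall>i. i \<ge> 1 \<longrightarrow> X i \<omega> \<le> 1"
    using AE_bernoulli_le_1[OF rv bern] by (simp add: AE_all_countable)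
  then have AE_out: "AE \<omega> in M. (?N \<omega>, ?K \<omega>) \<in> outcomes \<gamma> n"
    by eventually_elim (use assms(7,8) in \<open>auto intro: stop_in_outcomes\<close>)

  let ?good = "\<lambda>\<omega>. L (?N \<omega>) (?K \<omega>) < p \<and> p < U (?N \<omega>) (?K \<omega>)"
  \<comment> \<open>With the countably many values \<open>m\<close> and \<open>k\<close> fixed,
    \<open>L m k\<close> and \<open>U m k\<close> are constants, and only conditions on partial sums
    remain to be measured.\<close>
  have good_iff: "?good \<omega> \<longleftrightarrow>
      (\<exists>m k. ?N \<omega> = m \<and> ?S m \<omega> = k \<and> L m k < p \<and> p < U m k)" for \<omega>
    by (simp add: stop_sum_def)
  have good [measurable]: "{\<omega> \<in> space M. ?good \<omega>} \<in> events"
    unfolding good_iff stop_size_eq_iff by measurable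

  obtain A where A: "A \<in> events" "prob A \<le> \<delta> / 2"
    "\<And>\<omega>. \<omega> \<in> space M \<Longrightarrow> (?N \<omega>, ?K \<omega>) \<in> outcomes \<gamma> n \<Longrightarrow> p \<le> L (?N \<omega>) (?K \<omega>) \<Longrightarrow> \<omega> \<in> A"
  proof -
    define R where "R = {(m, k). (m, k) \<in> outcomes \<gamma> n \<and> p \<le> L m k}"
    show thesis
    proof (cases "R = {}")
      case True
      then show thesis
        using assms(9) by (intro that[of "{}"]) (auto simp: R_def)
    next
      case False
      have "R \<subseteq> outcomes \<gamma> n" by (auto simp: R_def)
      then obtain m k where mk: "(m, k) \<in> R" "\<And>m' k'. (m', k') \<in> R \<Longrightarrow> m' \<le> m \<and> k \<le> k'"
        using outcomes_least False by blast
      show thesis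
      proof (rule that[of "{\<omega> \<in> space M. k \<le> ?S m \<omega>}"])
        have "1 \<le> m" "m \<le> n" "k \<le> m" "p \<le> L m k"
          using mk(1) by (auto simp: R_def outcomes_def)
        then show "prob {\<omega> \<in> space M. k \<le> ?S m \<omega>} \<le> \<delta> / 2"
          unfolding tail using assms(2,11) by (intro lower_limit_ge_imp_tail_le[where q="L m k"]) auto
      next
        fix \<omega> assume \<omega>: "\<omega> \<in> space M" "(?N \<omega>, ?K \<omega>) \<in> outcomes \<gamma> n" "p \<le> L (?N \<omega>) (?K \<omega>)"
        \<comment> \<open>Samples are nonnegative, so continuing from the stopping time to
          \<open>m\<close> keeps the sum at least \<open>k\<close>.\<close>
        then have "?N \<omega> \<le> m" "k \<le> ?K \<omega>"
          using mk(2)[of "?N \<omega>" "?K \<omega>"] by (auto simp: R_def)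
        then show "\<omega> \<in> {\<omega> \<in> space M. k \<le> ?S m \<omega>}"
          using \<omega>(1) sum_initial_mono[of "?N \<omega>" m "\<lambda>i. X i \<omega>"] by (simp add: stop_sum_def)
      qed measurable
    qed
  qed

  obtain B where B: "B \<in> events" "prob B \<le> \<delta> / 2"
    "\<And>\<omega>. \<omega> \<in> space M \<Longrightarrow> (?N \<omega>, ?K \<omega>) \<in> outcomes \<gamma> n \<Longrightarrow> U (?N \<omega>) (?K \<omega>) \<le> p \<Longrightarrow> \<omega> \<in> B"
  proof -
    define R where "R = {(m, k). (m, k) \<in> outcomes \<gamma> n \<and> U m k \<le> p}"
    show thesis
    proof (cases "R = {}")
      case True
      then show thesis
        using assms(9) by (intro that[of "{}"]) (auto simp: R_def)
    next
      case False
      have "R \<subseteq> outcomes \<gamma> n" by (auto simp: R_def)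
      then obtain m k where mk: "(m, k) \<in> R" "\<And>m' k'. (m', k') \<in> R \<Longrightarrow> m \<le> m' \<and> k' \<le> k"
        using outcomes_greatest False by blast
      show thesis
      proof (rule that[of "{\<omega> \<in> space M. ?S m \<omega> < Suc k}"])
        have "1 \<le> m" "m \<le> n" "k \<le> m" "U m k \<le> p"
          using mk(1) by (auto simp: R_def outcomes_def)
        then show "prob {\<omega> \<in> space M. ?S m \<omega> < Suc k} \<le> \<delta> / 2"
          unfolding cdf using assms(3,12) by (intro upper_limit_le_imp_cdf_le[where q="U m k"]) auto
      next
        fix \<omega> assume \<omega>: "\<omega> \<in> space M" "(?N \<omega>, ?K \<omega>) \<in> outcomes \<gamma> n" "U (?N \<omega>) (?K \<omega>) \<le> p"
        \<comment> \<open>Now \<open>m\<close> precedes the stopping time, so the sum of the first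
          \<open>m\<close> samples is at most the final sum, hence at most \<open>k\<close>.\<close>
        then have "m \<le> ?N \<omega>" "?K \<omega> \<le> k"
          using mk(2)[of "?N \<omega>" "?K \<omega>"] by (auto simp: R_def)
        then show "\<omega> \<in> {\<omega> \<in> space M. ?S m \<omega> < Suc k}"
          using \<omega>(1) sum_initial_mono[of m "?N \<omega>" "\<lambda>i. X i \<omega>"] by (simp add: stop_sum_def)
      qed measurable
    qed
  qed

  \<comment> \<open>\<open>A\<close> and \<open>B\<close> are only known to cover failures with an
    outcome on the path, which is almost every failure.\<close>
  have "AE \<omega> in M. \<omega> \<in> space M - {\<omega> \<in> space M. ?good \<omega>} \<longrightarrow> \<omega> \<in> A \<union> B"
    using AE_out by eventually_elim (use A(3) B(3) in \<open>auto simp: not_less\<close>)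
  then have "prob (space M - {\<omega> \<in> space M. ?good \<omega>}) \<le> prob (A \<union> B)"
    using A(1) B(1) by (intro finite_measure_mono_AE) auto
  also have "\<dots> \<le> prob A + prob B"
    using A(1) B(1) by (rule measure_Un_le)
  also have "\<dots> \<le> \<delta>"
    using A(2) B(2) by simp
  finally show ?thesis
    unfolding prob_compl[OF good] by simp
qed

end
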